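(* Let $n\ge2$. The group describing the symmetry of the two $A_n$ elliptic Bailey transformations for the elliptic series of triangular type, namely the group generated by the transformations $s_0,s_1,t_1,b_1,b_2$ defined in the context, is isomorphic to $\mathfrak{S}_4\times(\mathfrak{S}_2)^2$, where $\mathfrak{S}_k$ denotes the symmetric group of degree $k$.
   Context: Fix parameters $a_1,\dots,a_n\in\mathbb{C}$ and set $|a|=a_1+\cdots+a_n$. The triangular series has parameters $s$; $c_0,c_1,c_2$; $-N\delta,d_1,d_2$; $\{a_i\}$; $\{x_i\}$, and is symmetric in $c_0,c_1,c_2$ and in $d_1,d_2$. The transformations act on pairs $(\vec v,x)$ with $\vec v={}^t[s,c_0,c_1,c_2,d_1,d_2,\delta]\in\mathbb{C}^7$, $x=(x_1,\dots,x_n)\in\mathbb{C}^n$, and all fix $\delta$: $s_i$ ($i=0,1$) exchanges $c_i$ and $c_{i+1}$; $t_1$ exchanges $d_1$ and $d_2$; these fix everything else; $b_1$ (parameter change of the transformation Bailey I) sends $(s,c_0,c_1,c_2,d_1,d_2)$ to $(\delta+2s-c_0-d_1-d_2,\ \delta+s-d_1-d_2,\ c_1,\ c_2,\ \delta+s-c_0-d_2,\ \delta+s-c_0-d_1)$ and fixes $x$; $b_2$ (parameter change of the transformation Bailey II) sends $(s,c_0,c_1,c_2,d_1,d_2)$ to $(\delta+2s-c_0-c_1-c_2,\ \delta+s-c_1-c_2,\ \delta+s-c_0-c_2,\ \delta+s-c_0-c_1,\ d_1,\ d_2)$ and sends $x_i$ to $a_i-x_i-|a|$ for $1\le i\le n$.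 The group operation is composition. *)

theory Defs
  imports
    "HOL-Analysis.Cartesian_Space"
    "HOL-Algebra.Bij"
    "HOL-Algebra.Generated_Groups"
    "HOL-Algebra.Sym_Groups"
begin

text \<open>
  A state is a pair \<open>(v, x)\<close> with \<open>v = [s, c0, c1, c2, d1, d2, \<delta>]\<close>, so \<open>v $ 1\<close> is \<open>s\<close> and
  \<open>v $ 7\<close> is \<open>\<delta>\<close> (as elements of the index type, \<open>7 = 0\<close>), and \<open>x = (x\<^sub>1, \<dots>, x\<^sub>n)\<close> where
  \<open>n = CARD('n)\<close>.
\<close>

type_synonym 'n state = "(complex ^ 7) \<times> (complex ^ 'n)"

definition tri_s0 :: "'n::finite state \<Rightarrow> 'n state" where
  "tri_s0 = (\<lambda>(v, x).
     let s = v $ 1; c0 = v $ 2; c1 = v $ 3; c2 = v $ 4; d1 = v $ 5; d2 = v $ 6; \<delta> = v $ 7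
     in (vector [s, c1, c0, c2, d1, d2, \<delta>], x))"

definition tri_s1 :: "'n::finite state \<Rightarrow> 'n state" where
  "tri_s1 = (\<lambda>(v, x).
     let s = v $ 1; c0 = v $ 2; c1 = v $ 3; c2 = v $ 4; d1 = v $ 5; d2 = v $ 6; \<delta> = v $ 7
     in (vector [s, c0, c2, c1, d1, d2, \<delta>], x))"

definition tri_t1 :: "'n::finite state \<Rightarrow> 'n state" where
  "tri_t1 = (\<lambda>(v, x).
     let s = v $ 1; c0 = v $ 2; c1 = v $ 3; c2 = v $ 4; d1 = v $ 5; d2 = v $ 6; \<delta> = v $ 7
     in (vector [s, c0, c1, c2, d2, d1, \<delta>], x))"

definition tri_b1 :: "'n::finite state \<Rightarrow> 'n state" where
  "tri_b1 = (\<lambda>(v, x).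
     let s = v $ 1; c0 = v $ 2; c1 = v $ 3; c2 = v $ 4; d1 = v $ 5; d2 = v $ 6; \<delta> = v $ 7
     in (vector [\<delta> + 2 * s - c0 - d1 - d2,
                 \<delta> + s - d1 - d2, c1, c2,
                 \<delta> + s - c0 - d2, \<delta> + s - c0 - d1,
                 \<delta>],
         x))"

definition tri_b2 :: "complex ^ 'n \<Rightarrow> 'n::finite state \<Rightarrow> 'n state" where
  "tri_b2 a = (\<lambda>(v, x).
     let s = v $ 1; c0 = v $ 2; c1 = v $ 3; c2 = v $ 4; d1 = v $ 5; d2 = v $ 6; \<delta> = v $ 7
     in (vector [\<delta> + 2 * s - c0 - c1 - c2,
                 \<delta> + s - c1 - c2, \<delta> + s - c0 - c2, \<delta> + s - c0 - c1,
                 d1, d2,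
                 \<delta>],
         (\<chi> i. a $ i - x $ i - (\<Sum>j\<in>UNIV. a $ j))))"

definition triangular_bailey_group :: "complex ^ 'n \<Rightarrow> ('n::finite state \<Rightarrow> 'n state) monoid" where
  "triangular_bailey_group a =
     subgroup_generated (BijGroup UNIV) {tri_s0, tri_s1, tri_t1, tri_b1, tri_b2 a}"


text \<open>
  The constant \<^const>\<open>subgroup_generated\<close> discards generators outside the carrier; the lemma
  \<open>tri_generators_in_carrier\<close> below shows that nothing is discarded here.
\<close>

lemma exhaust_7:
  fixes x :: 7
  shows "x = 1 \<or> x = 2 \<or> x = 3 \<or> x = 4 \<or> x = 5 \<or> x = 6 \<or> x = 7"
proof (induct x)
  case (of_int z)
  then have "z = 0 \<or> z = 1 \<or> z = 2 \<or> z = 3 \<or> z = 4 \<or> z = 5 \<or> z = 6" by fastforce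
  then show ?case by auto
qed

lemma forall_7:
  "(\<forall>i::7. P i) \<longleftrightarrow> P 1 \<and> P 2 \<and> P 3 \<and> P 4 \<and> P 5 \<and> P 6 \<and> P 7"
  by (metis exhaust_7)

lemma vector_7 [simp]:
  "(vector [p, q, r, t, u, w, z] :: ('a::zero)^7) $ 1 = p"
  "(vector [p, q, r, t, u, w, z] :: ('a::zero)^7) $ 2 = q"
  "(vector [p, q, r, t, u, w, z] :: ('a::zero)^7) $ 3 = r"
  "(vector [p, q, r, t, u, w, z] :: ('a::zero)^7) $ 4 = t"
  "(vector [p, q, r, t, u, w, z] :: ('a::zero)^7) $ 5 = u"
  "(vector [p, q, r, t, u, w, z] :: ('a::zero)^7) $ 6 = w"
  "(vector [p, q, r, t, u, w, z] :: ('a::zero)^7) $ 7 = z"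
  unfolding vector_def by simp_all

lemma tri_involutions:
  "tri_s0 (tri_s0 y) = y" "tri_s1 (tri_s1 y) = y" "tri_t1 (tri_t1 y) = y"
  "tri_b1 (tri_b1 y) = y" "tri_b2 a (tri_b2 a y) = y"
  unfolding tri_s0_def tri_s1_def tri_t1_def tri_b1_def tri_b2_def
  by (cases y; simp del: vector_7(7) add: Let_def vec_eq_iff forall_7 vector_7; simp add: vector_7[simplified])+

lemma tri_generators_in_carrier:
  "{tri_s0, tri_s1, tri_t1, tri_b1, tri_b2 a} \<subseteq> carrier (BijGroup UNIV)"
  using tri_involutions
  by (auto simp: BijGroup_def Bij_def intro!: involuntory_imp_bij)

lemma carrier_triangular_bailey_group:
  "carrier (triangular_bailey_group a) =
     generate (BijGroup UNIV) {tri_s0, tri_s1, tri_t1, tri_b1, tri_b2 a}"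
  unfolding triangular_bailey_group_def carrier_subgroup_generated
  using tri_generators_in_carrier[of a] by (simp add: Int_absorb1)

lemma mult_triangular_bailey_group:
  assumes "g \<in> carrier (triangular_bailey_group a)" "h \<in> carrier (triangular_bailey_group a)"
  shows "g \<otimes>\<^bsub>triangular_bailey_group a\<^esub> h = g \<circ> h"
proof -
  have "carrier (triangular_bailey_group a) \<subseteq> carrier (BijGroup UNIV)"
    unfolding carrier_triangular_bailey_group
    by (rule group.generate_incl[OF group_BijGroup tri_generators_in_carrier])
  then show ?thesis
    using assms unfolding triangular_bailey_group_def
    by (auto simp: subgroup_generated_def BijGroup_def compose_def fun_eq_iff)
qed

end

theory Submission
  imports Defs
begin

text \<open>
  The seven parameters have linear coordinates in which the five generators act visibly. Put
  \<open>c\<^sub>3 = \<delta> + s - d\<^sub>1 - d\<^sub>2\<close> and \<open>p\<^sub>j = s - d\<^sub>j\<close> for \<open>j = 1, 2\<close>.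
  Since \<open>c\<^sub>3 = \<delta> - s + p\<^sub>1 + p\<^sub>2\<close>, the numbers \<open>c\<^sub>3, c\<^sub>0, c\<^sub>1, c\<^sub>2, p\<^sub>1, p\<^sub>2, \<delta>\<close>
  determine the parameters, and they can be prescribed arbitrarily. The map \<open>b\<^sub>1\<close> adds
  \<open>c\<^sub>3 - c\<^sub>0\<close> to each of \<open>s, c\<^sub>0, d\<^sub>1, d\<^sub>2\<close>; hence it exchanges \<open>c\<^sub>0\<close> and \<open>c\<^sub>3\<close> and
  fixes the other coordinates. So \<open>b\<^sub>1, s\<^sub>0, s\<^sub>1\<close> are the adjacent transpositions of the list
  \<open>c\<^sub>3, c\<^sub>0, c\<^sub>1, c\<^sub>2\<close> and generate \<open>\<SS>\<^sub>4\<close>, while \<open>t\<^sub>1\<close> exchanges \<open>p\<^sub>1\<close> and \<open>p\<^sub>2\<close>.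
  Finally \<open>b\<^sub>2\<close> adds \<open>e = 2\<delta> + p\<^sub>1 + p\<^sub>2 - c\<^sub>0 - c\<^sub>1 - c\<^sub>2 - c\<^sub>3\<close> (\<open>bailey_shift\<close>) to
  all six of the \<open>c\<^sub>i\<close> and \<open>p\<^sub>j\<close>. As \<open>e\<close> is symmetric in the \<open>c\<^sub>i\<close> and in the \<open>p\<^sub>j\<close>, and
  the permutations leave \<open>x\<close> fixed, the involution \<open>b\<^sub>2\<close> commutes with all of them; it
  contributes the remaining factor \<open>\<SS>\<^sub>2\<close>.

  Accordingly \<open>triangular_action\<close> lets a triple in \<open>\<SS>\<^sub>4 \<times> \<SS>\<^sub>2 \<times> \<SS>\<^sub>2\<close> act on states. It is a
  homomorphism (\<open>triangular_action_hom\<close>), it is faithful (\<open>triangular_action_inj\<close>), as one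
  sees at a single state with distinct \<open>c\<^sub>i\<close>, distinct \<open>p\<^sub>j\<close> and \<open>e \<noteq> 0\<close>, and its image is the group
  generated by the five maps (\<open>triangular_action_image\<close>).
\<close>

(* The indices 1, 2, ... are to stay numerals, so that the coordinate facts keep matching. *)
declare One_nat_def [simp del]

section \<open>Adjacent transpositions generate the symmetric group\<close>

text \<open>
  A permutation is a product of transpositions, and a transposition of \<open>k < l\<close> is a word in the
  transpositions of \<open>i\<close> and \<open>i + 1\<close> with \<open>k \<le> i < l\<close>; so it is enough to multiply by such words.
\<close>

lemma permutes_induct_adjacent [consumes 1, case_names id step]:
  assumes "q permutes {1..n}"
    and base: "P id"
    and step: "\<And>i q. \<lbrakk>1 \<le> i; i < n; q permutes {1..n}; P q\<rbrakk>
      \<Longrightarrow> P (Transposition.transpose i (Suc i) \<circ> q)"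
  shows "P q"
  using assms(1) finite_atLeastAtMost
proof (induction rule: permutes_induct)
  case id
  show ?case by (rule base)
next
  case (swap i j q)
  have word: "P (apply_adj_transps is \<circ> q)" if "set is \<subseteq> {1..<n}" for "is"
    using that
  proof (induction "is")
    case Nil
    then show ?case using swap by simp
  next
    case (Cons i "is")
    then have "apply_adj_transps is permutes {1..n}"
      by (intro permutes_apply_adj_transps) auto
    then have "apply_adj_transps is \<circ> q permutes {1..n}"
      using swap by (auto intro: permutes_compose)
    then have "P (Transposition.transpose i (Suc i) \<circ> (apply_adj_transps is \<circ> q))"
      using Cons by (intro step) (auto simp: o_def)
    then show ?case
      by (simp only: apply_adj_transps_Cons comp_assoc Suc_eq_plus1)
  qed
  have ordered: "P (Transposition.transpose k l \<circ> q)" if "k < l" "k \<in> {1..n}" "l \<in> {1..n}" for k l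
    using word[of "adj_transp_seq k l"] that by (simp add: adj_transp_seq_correct set_adj_transp_seq)
  show ?case
    using ordered[of i j] ordered[of j i] swap by (metis linorder_neqE_nat transpose_commute)
qed

section \<open>Coordinates adapted to the Bailey transformations\<close>

text \<open>
  The list \<open>c\<^sub>3, c\<^sub>0, c\<^sub>1, c\<^sub>2\<close> is indexed by \<open>{1..4}\<close>; its first entry is \<open>c\<^sub>3\<close>, so that
  \<open>b\<^sub>1\<close> becomes a transposition of neighbours.
\<close>

definition from_coords ::
  "(nat \<Rightarrow> complex) \<Rightarrow> (nat \<Rightarrow> complex) \<Rightarrow> complex \<Rightarrow> complex ^ 'n \<Rightarrow> 'n::finite state" where
  "from_coords c p \<delta> x =
     (let s = \<delta> + p 1 + p 2 - c 1 in (vector [s, c 2, c 3, c 4, s - p 1, s - p 2, \<delta>], x))"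

definition c_coord :: "'n::finite state \<Rightarrow> nat \<Rightarrow> complex" where
  "c_coord y i = (let v = fst y in
     if i = 1 then v $ 7 + v $ 1 - v $ 5 - v $ 6
     else if i = 2 then v $ 2 else if i = 3 then v $ 3 else v $ 4)"

definition p_coord :: "'n::finite state \<Rightarrow> nat \<Rightarrow> complex" where
  "p_coord y j = (let v = fst y in if j = 1 then v $ 1 - v $ 5 else v $ 1 - v $ 6)"

lemma atLeastAtMost_1_4: "{1..4::nat} = {1, 2, 3, 4}"
  and atLeastAtMost_1_2: "{1..2::nat} = {1, 2}"
  by auto

text \<open>The numeral 7 of type \<open>7\<close> simplifies to 0, so the last component needs a rule of its own.\<close>

lemma vector_7_last: "(vector [p, q, r, t, u, w, z] :: complex ^ 7) $ 0 = z"
proof -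
  have "(0 :: 7) = 7" by simp
  then show ?thesis by (metis vector_7(7))
qed

lemma c_coord_from_coords: "i \<in> {1..4} \<Longrightarrow> c_coord (from_coords c p \<delta> x) i = c i"
  unfolding atLeastAtMost_1_4
  by (auto simp: c_coord_def from_coords_def Let_def vector_7_last)

lemma p_coord_from_coords: "j \<in> {1..2} \<Longrightarrow> p_coord (from_coords c p \<delta> x) j = p j"
  unfolding atLeastAtMost_1_2
  by (auto simp: p_coord_def from_coords_def Let_def)

lemma last_from_coords: "fst (from_coords c p \<delta> x) $ 7 = \<delta>"
  by (simp add: from_coords_def Let_def vector_7_last)

lemma snd_from_coords: "snd (from_coords c p \<delta> x) = x"
  by (simp add: from_coords_def Let_def)

lemma from_coords_cong:
  assumes "\<And>i. i \<in> {1..4} \<Longrightarrow> c i = c' i" "\<And>j. j \<in> {1..2} \<Longrightarrow> p j = p' j"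
    "\<delta> = \<delta>'" "x = x'"
  shows "from_coords c p \<delta> x = from_coords c' p' \<delta>' x'"
  using assms by (simp add: from_coords_def)

lemma from_coords_coords: "from_coords (c_coord y) (p_coord y) (fst y $ 7) (snd y) = y"
  by (cases y)
    (simp add: from_coords_def c_coord_def p_coord_def Let_def vec_eq_iff forall_7 vector_7_last)

lemma from_coords_cases:
  obtains c p \<delta> x where "y = from_coords c p \<delta> x"
  by (metis from_coords_coords)

section \<open>The generators in these coordinates\<close>

definition permute_coords ::
  "(nat \<Rightarrow> nat) \<Rightarrow> (nat \<Rightarrow> nat) \<Rightarrow> 'n::finite state \<Rightarrow> 'n state" where
  "permute_coords \<sigma> \<tau> y =
     from_coords (c_coord y \<circ> inv' \<sigma>) (p_coord y \<circ> inv' \<tau>) (fst y $ 7) (snd y)"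

lemma permute_from_coords:
  assumes "\<sigma> permutes {1..4}" "\<tau> permutes {1..2}"
  shows "permute_coords \<sigma> \<tau> (from_coords c p \<delta> x) = from_coords (c \<circ> inv' \<sigma>) (p \<circ> inv' \<tau>) \<delta> x"
  unfolding permute_coords_def last_from_coords snd_from_coords
  by (intro from_coords_cong)
    (simp_all add: c_coord_from_coords p_coord_from_coords
      permutes_in_image[OF permutes_inv[OF assms(1)]]
      permutes_in_image[OF permutes_inv[OF assms(2)]] del: atLeastAtMost_iff)

lemma permute_coords_id: "permute_coords id id = id"
  by (simp add: fun_eq_iff permute_coords_def from_coords_coords)

text \<open>The inverses in the definition make this a left action, which matches composition of maps.\<close>

lemma permute_coords_comp:
  assumes "\<sigma> permutes {1..4}" "\<sigma>' permutes {1..4}" "\<tau> permutes {1..2}" "\<tau>' permutes {1..2}"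
  shows "permute_coords \<sigma> \<tau> \<circ> permute_coords \<sigma>' \<tau>' = permute_coords (\<sigma> \<circ> \<sigma>') (\<tau> \<circ> \<tau>')"
proof
  fix y :: "'n::finite state"
  obtain c p \<delta> x where y: "y = from_coords c p \<delta> x"
    by (rule from_coords_cases)
  show "(permute_coords \<sigma> \<tau> \<circ> permute_coords \<sigma>' \<tau>') y
      = permute_coords (\<sigma> \<circ> \<sigma>') (\<tau> \<circ> \<tau>') y"
    using assms
    by (simp add: y permute_from_coords permutes_compose o_inv_distrib permutes_bij comp_assoc)
qed

lemma tri_b1_permute: "tri_b1 = permute_coords (Transposition.transpose 1 2) id"
  by (auto simp: fun_eq_iff tri_b1_def permute_coords_def from_coords_def c_coord_def p_coord_def
      Let_def vec_eq_iff forall_7 vector_7_last Transposition.transpose_def)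

lemma tri_s0_permute: "tri_s0 = permute_coords (Transposition.transpose 2 3) id"
  by (auto simp: fun_eq_iff tri_s0_def permute_coords_def from_coords_def c_coord_def p_coord_def
      Let_def vec_eq_iff forall_7 vector_7_last Transposition.transpose_def)

lemma tri_s1_permute: "tri_s1 = permute_coords (Transposition.transpose 3 4) id"
  by (auto simp: fun_eq_iff tri_s1_def permute_coords_def from_coords_def c_coord_def p_coord_def
      Let_def vec_eq_iff forall_7 vector_7_last Transposition.transpose_def)

lemma tri_t1_permute: "tri_t1 = permute_coords id (Transposition.transpose 1 2)"
  by (auto simp: fun_eq_iff tri_t1_def permute_coords_def from_coords_def c_coord_def p_coord_def
      Let_def vec_eq_iff forall_7 vector_7_last Transposition.transpose_def)

definition bailey_shift :: "(nat \<Rightarrow> complex) \<Rightarrow> (nat \<Rightarrow> complex) \<Rightarrow> complex \<Rightarrow> complex" where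
  "bailey_shift c p \<delta> = 2 * \<delta> + (\<Sum>j\<in>{1..2}. p j) - (\<Sum>i\<in>{1..4}. c i)"

lemma tri_b2_from_coords:
  "tri_b2 a (from_coords c p \<delta> x) =
     from_coords (\<lambda>i. c i + bailey_shift c p \<delta>) (\<lambda>j. p j + bailey_shift c p \<delta>) \<delta>
       (\<chi> i. a $ i - x $ i - (\<Sum>j\<in>UNIV. a $ j))"
  by (simp add: tri_b2_def from_coords_def bailey_shift_def Let_def vec_eq_iff forall_7
      vector_7_last atLeastAtMost_1_4 atLeastAtMost_1_2)

lemma bailey_shift_permute:
  assumes "\<sigma> permutes {1..4}" "\<tau> permutes {1..2}"
  shows "bailey_shift (c \<circ> \<sigma>) (p \<circ> \<tau>) \<delta> = bailey_shift c p \<delta>"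
  using sum.permute[OF assms(1), of c] sum.permute[OF assms(2), of p]
  by (simp add: bailey_shift_def)

lemma tri_b2_permute_commute:
  fixes a :: "complex ^ 'n::finite"
  assumes "\<sigma> permutes {1..4}" "\<tau> permutes {1..2}"
  shows "tri_b2 a \<circ> permute_coords \<sigma> \<tau> = permute_coords \<sigma> \<tau> \<circ> tri_b2 a"
proof
  fix y :: "'n state"
  obtain c p \<delta> x where y: "y = from_coords c p \<delta> x"
    by (rule from_coords_cases)
  show "(tri_b2 a \<circ> permute_coords \<sigma> \<tau>) y = (permute_coords \<sigma> \<tau> \<circ> tri_b2 a) y"
    using assms
    by (simp add: y permute_from_coords tri_b2_from_coords bailey_shift_permute permutes_inv)
      (simp add: o_def)
qed

section \<open>The faithful action of the product of symmetric groups\<close>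

text \<open>
  The first factor \<open>\<SS>\<^sub>2\<close> permutes the \<open>p\<^sub>j\<close>; the second one is merely a group of order two, whose
  nontrivial element acts as \<open>b\<^sub>2\<close>.
\<close>

definition bailey_flip :: "complex ^ 'n \<Rightarrow> (nat \<Rightarrow> nat) \<Rightarrow> 'n::finite state \<Rightarrow> 'n state" where
  "bailey_flip a \<rho> = (if \<rho> = id then id else tri_b2 a)"

definition triangular_action ::
  "complex ^ 'n \<Rightarrow> (nat \<Rightarrow> nat) \<times> (nat \<Rightarrow> nat) \<times> (nat \<Rightarrow> nat) \<Rightarrow> 'n::finite state \<Rightarrow> 'n state"
  where "triangular_action a = (\<lambda>(\<sigma>, \<tau>, \<rho>). permute_coords \<sigma> \<tau> \<circ> bailey_flip a \<rho>)"

lemma permutes_1_2_iff: "\<rho> permutes {1..2::nat} \<longleftrightarrow> \<rho> = id \<or> \<rho> = Transposition.transpose 1 2"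
  unfolding atLeastAtMost_1_2 by (rule permutes_doubleton_iff)

lemma transpose_1_2_neq_id: "Transposition.transpose 1 (2::nat) \<noteq> id"
  by (metis id_apply one_eq_numeral_iff semiring_norm(83) transpose_apply_first)

text \<open>Since \<open>\<SS>\<^sub>2\<close> has only one nontrivial element, multiplicativity says that \<open>b\<^sub>2\<close> is an involution.\<close>

lemma bailey_flip_comp:
  assumes "\<rho> permutes {1..2}" "\<rho>' permutes {1..2}"
  shows "bailey_flip a \<rho> \<circ> bailey_flip a \<rho>' = bailey_flip a (\<rho> \<circ> \<rho>')"
proof -
  have "tri_b2 a \<circ> tri_b2 a = id"
    by (simp add: fun_eq_iff tri_involutions)
  then show ?thesis
    using assms[unfolded permutes_1_2_iff] transpose_1_2_neq_id
    by (elim disjE) (simp_all add: bailey_flip_def)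
qed

lemma bailey_flip_permute_commute:
  assumes "\<sigma> permutes {1..4}" "\<tau> permutes {1..2}"
  shows "bailey_flip a \<rho> \<circ> permute_coords \<sigma> \<tau> = permute_coords \<sigma> \<tau> \<circ> bailey_flip a \<rho>"
  by (simp add: bailey_flip_def tri_b2_permute_commute[OF assms])

lemma triangular_action_comp:
  assumes "\<sigma> permutes {1..4}" "\<tau> permutes {1..2}" "\<rho> permutes {1..2}"
    and "\<sigma>' permutes {1..4}" "\<tau>' permutes {1..2}" "\<rho>' permutes {1..2}"
  shows "triangular_action a (\<sigma>, \<tau>, \<rho>) \<circ> triangular_action a (\<sigma>', \<tau>', \<rho>')
    = triangular_action a (\<sigma> \<circ> \<sigma>', \<tau> \<circ> \<tau>', \<rho> \<circ> \<rho>')"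
proof -
  have "triangular_action a (\<sigma>, \<tau>, \<rho>) \<circ> triangular_action a (\<sigma>', \<tau>', \<rho>')
    = permute_coords \<sigma> \<tau> \<circ> (bailey_flip a \<rho> \<circ> permute_coords \<sigma>' \<tau>') \<circ> bailey_flip a \<rho>'"
    by (simp add: triangular_action_def comp_assoc)
  also have "\<dots> = (permute_coords \<sigma> \<tau> \<circ> permute_coords \<sigma>' \<tau>') \<circ> (bailey_flip a \<rho> \<circ> bailey_flip a \<rho>')"
    using assms by (simp add: bailey_flip_permute_commute comp_assoc)
  also have "\<dots> = triangular_action a (\<sigma> \<circ> \<sigma>', \<tau> \<circ> \<tau>', \<rho> \<circ> \<rho>')"
    using assms by (simp add: permute_coords_comp bailey_flip_comp triangular_action_def)
  finally show ?thesis .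
qed

lemma triangular_action_id: "triangular_action a (id, id, id) = id"
  by (simp add: triangular_action_def bailey_flip_def permute_coords_id)

lemma carrier_BijGroup_UNIV: "carrier (BijGroup UNIV) = {f. bij f}"
  by (auto simp: BijGroup_def Bij_def)

lemma mult_BijGroup_UNIV: "bij f \<Longrightarrow> bij g \<Longrightarrow> f \<otimes>\<^bsub>BijGroup UNIV\<^esub> g = f \<circ> g"
  by (simp add: BijGroup_def Bij_def compose_def fun_eq_iff)

lemma one_BijGroup_UNIV: "\<one>\<^bsub>BijGroup UNIV\<^esub> = id"
  by (simp add: BijGroup_def fun_eq_iff)

lemma triangular_action_bij:
  assumes "\<sigma> permutes {1..4}" "\<tau> permutes {1..2}" "\<rho> permutes {1..2}"
  shows "bij (triangular_action a (\<sigma>, \<tau>, \<rho>))"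
proof (rule o_bij)
  show "triangular_action a (inv' \<sigma>, inv' \<tau>, inv' \<rho>) \<circ> triangular_action a (\<sigma>, \<tau>, \<rho>) = id"
    "triangular_action a (\<sigma>, \<tau>, \<rho>) \<circ> triangular_action a (inv' \<sigma>, inv' \<tau>, inv' \<rho>) = id"
    using assms assms[THEN permutes_inv]
    by (simp_all add: triangular_action_comp permutes_inv_o triangular_action_id)
qed

abbreviation (input) S4_S2_S2 where
  "S4_S2_S2 \<equiv> sym_group 4 \<times>\<times> (sym_group 2 \<times>\<times> sym_group 2)"

lemma group_S4_S2_S2: "group S4_S2_S2"
  by (intro DirProd_group sym_group_is_group)

lemma triangular_action_hom: "triangular_action a \<in> hom S4_S2_S2 (BijGroup UNIV)"
  by (auto simp: hom_def carrier_BijGroup_UNIV mult_BijGroup_UNIV sym_group_carrier sym_group_mult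
      triangular_action_bij triangular_action_comp)

text \<open>
  The orbit of one state detects every triple: let \<open>1, 2, 3, 4\<close> be the list of the \<open>c\<^sub>i\<close>,
  \<open>1, 2\<close> that of the \<open>p\<^sub>j\<close>, and \<open>\<delta> = 0\<close>. There the shift
  is \<open>3 - 10 = -7\<close>, so \<open>b\<^sub>2\<close> makes all the \<open>c\<^sub>i\<close> negative and no permutation can undo it; without
  \<open>b\<^sub>2\<close>, the positions of the distinct coordinates give the two permutations.
\<close>

lemma triangular_action_eq_idD:
  fixes a :: "complex ^ 'n::finite"
  assumes perms: "\<sigma> permutes {1..4}" "\<tau> permutes {1..2}" "\<rho> permutes {1..2}"
    and trivial: "triangular_action a (\<sigma>, \<tau>, \<rho>) = id"
  shows "\<sigma> = id \<and> \<tau> = id \<and> \<rho> = id"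
proof -
  define y where "y = from_coords of_nat of_nat 0 (0 :: complex ^ 'n)"
  have shift: "bailey_shift of_nat of_nat 0 = -7"
    by (simp add: bailey_shift_def atLeastAtMost_1_4 atLeastAtMost_1_2)
  have fixed: "permute_coords \<sigma> \<tau> (bailey_flip a \<rho> y) = y"
    using fun_cong[OF trivial, of y] by (simp add: triangular_action_def)
  have \<rho>: "\<rho> = id"
  proof (rule ccontr)
    assume "\<rho> \<noteq> id"
    then have "c_coord (permute_coords \<sigma> \<tau> (bailey_flip a \<rho> y)) 1 = of_nat (inv' \<sigma> 1) - 7"
      using perms
      by (simp add: y_def bailey_flip_def tri_b2_from_coords permute_from_coords
          c_coord_from_coords shift)
    then have "complex_of_nat (inv' \<sigma> 1) - 7 = of_nat 1"
      unfolding fixed by (simp add: y_def c_coord_from_coords)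
    then have "complex_of_nat (inv' \<sigma> 1) = of_nat 8"
      by (simp add: algebra_simps)
    then have "inv' \<sigma> 1 = 8"
      by (simp only: of_nat_eq_iff)
    moreover have "inv' \<sigma> 1 \<in> {1..4}"
      using permutes_in_image[OF permutes_inv[OF perms(1)], of 1] by simp
    ultimately show False by simp
  qed
  have moved: "from_coords (of_nat \<circ> inv' \<sigma>) (of_nat \<circ> inv' \<tau>) 0 (0 :: complex ^ 'n) = y"
    using fixed perms by (simp add: \<rho> bailey_flip_def y_def permute_from_coords)
  have "inv' \<sigma> i = i" if "i \<in> {1..4}" for i
    using arg_cong[OF moved, of "\<lambda>y. c_coord y i"] that by (simp add: y_def c_coord_from_coords)
  then have "inv' \<sigma> = inv' id"
    using permutes_not_in[OF permutes_inv[OF perms(1)]] by (auto simp: fun_eq_iff)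
  moreover have "inv' \<tau> j = j" if "j \<in> {1..2}" for j
    using arg_cong[OF moved, of "\<lambda>y. p_coord y j"] that by (simp add: y_def p_coord_from_coords)
  then have "inv' \<tau> = inv' id"
    using permutes_not_in[OF permutes_inv[OF perms(2)]] by (auto simp: fun_eq_iff)
  ultimately show ?thesis
    using \<rho> perms by (metis permutes_inv_inv inv_id)
qed

lemma triangular_action_inj: "inj_on (triangular_action a) (carrier S4_S2_S2)"
  unfolding inj_on_one_iff'[OF triangular_action_hom group_S4_S2_S2 group_BijGroup]
  using triangular_action_eq_idD
  by (auto simp: one_BijGroup_UNIV sym_group_carrier sym_group_one)

section \<open>The image of the action\<close>

lemma triangular_action_image:
  "triangular_action a ` carrier S4_S2_S2 = carrier (triangular_bailey_group a)"
proof
  interpret action: group_hom S4_S2_S2 "BijGroup UNIV" "triangular_action a"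
    by (intro group_hom.intro group_hom_axioms.intro group_S4_S2_S2 group_BijGroup
        triangular_action_hom)
  let ?gens = "{tri_s0, tri_s1, tri_t1, tri_b1, tri_b2 a}"
  let ?G = "generate (BijGroup UNIV) ?gens"
  have comp_closed: "f \<circ> g \<in> ?G" if "f \<in> ?G" "g \<in> ?G" for f g
    using generate.eng[OF that] that
      action.H.generate_incl[OF tri_generators_in_carrier[of a]]
    by (metis (no_types, lifting) carrier_BijGroup_UNIV mem_Collect_eq mult_BijGroup_UNIV subsetD)
  have id_in: "id \<in> ?G"
    using generate.one[of "BijGroup UNIV" ?gens] by (simp add: one_BijGroup_UNIV)
  have c_perms: "permute_coords \<sigma> id \<in> ?G" if "\<sigma> permutes {1..4}" for \<sigma>
    using that
  proof (induction rule: permutes_induct_adjacent)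
    case id
    show ?case unfolding permute_coords_id by (rule id_in)
  next
    case (step i \<sigma>)
    have "i = 1 \<or> i = 2 \<or> i = 3"
      using step by auto
    then have "permute_coords (Transposition.transpose i (Suc i)) id \<in> ?gens"
      by (auto simp: tri_b1_permute tri_s0_permute tri_s1_permute)
    then have "permute_coords (Transposition.transpose i (Suc i)) id \<circ> permute_coords \<sigma> id \<in> ?G"
      using step by (intro comp_closed[OF generate.incl])
    moreover have "Transposition.transpose i (Suc i) permutes {1..4}"
      using step by (intro permutes_swap_id) auto
    ultimately have "permute_coords (Transposition.transpose i (Suc i) \<circ> \<sigma>) id \<in> ?G"
      using step by (simp add: permute_coords_comp)
    then show ?case
      by (simp add: o_def id_def)
  qed
  have "tri_t1 \<in> ?G"
    by (rule generate.incl) simp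
  then have p_perms: "permute_coords id \<tau> \<in> ?G" if "\<tau> permutes {1..2}" for \<tau>
    using that[unfolded permutes_1_2_iff] id_in
    by (elim disjE) (simp_all only: permute_coords_id flip: tri_t1_permute)
  have "tri_b2 a \<in> ?G"
    by (rule generate.incl) simp
  then have flips: "bailey_flip a \<rho> \<in> ?G" for \<rho>
    using id_in by (simp add: bailey_flip_def)
  have "triangular_action a (\<sigma>, \<tau>, \<rho>) \<in> ?G" if "\<sigma> permutes {1..4}" "\<tau> permutes {1..2}" for \<sigma> \<tau> \<rho>
    using comp_closed[OF comp_closed[OF c_perms[OF that(1)] p_perms[OF that(2)]] flips[of \<rho>]] that
    by (simp add: permute_coords_comp triangular_action_def)
  then show "triangular_action a ` carrier S4_S2_S2 \<subseteq> carrier (triangular_bailey_group a)"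
    by (auto simp: carrier_triangular_bailey_group sym_group_carrier)
  have perm_in: "permute_coords \<sigma> \<tau> \<in> triangular_action a ` carrier S4_S2_S2"
    if "\<sigma> permutes {1..4}" "\<tau> permutes {1..2}" for \<sigma> \<tau>
    using that
    by (intro image_eqI[where x = "(\<sigma>, \<tau>, id)"])
      (auto simp: triangular_action_def bailey_flip_def sym_group_carrier)
  have "tri_b2 a \<in> triangular_action a ` carrier S4_S2_S2"
    using transpose_1_2_neq_id
    by (intro image_eqI[where x = "(id, id, Transposition.transpose 1 2)"])
      (auto simp: triangular_action_def bailey_flip_def sym_group_carrier permute_coords_id
        intro: permutes_swap_id)
  then have "?gens \<subseteq> triangular_action a ` carrier S4_S2_S2"
    unfolding tri_b1_permute tri_s0_permute tri_s1_permute tri_t1_permute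
    by (auto intro!: perm_in permutes_swap_id simp del: carrier_DirProd)
  then show "carrier (triangular_bailey_group a) \<subseteq> triangular_action a ` carrier S4_S2_S2"
    unfolding carrier_triangular_bailey_group
    by (rule action.H.generate_subgroup_incl[OF _ action.img_is_subgroup])
qed

theorem proposition3p4:
  fixes a :: "complex ^ 'n::finite"
  assumes "CARD('n) \<ge> 2"
  shows "triangular_bailey_group a \<cong> sym_group 4 \<times>\<times> (sym_group 2 \<times>\<times> sym_group 2)"
proof -
  have "triangular_action a \<in> hom S4_S2_S2 (triangular_bailey_group a)"
    using triangular_action_hom[of a] triangular_action_image[of a]
    by (auto simp: hom_def triangular_bailey_group_def subgroup_generated_def)
  then have "triangular_action a \<in> iso S4_S2_S2 (triangular_bailey_group a)"
    using triangular_action_inj triangular_action_image by (auto simp: iso_def bij_betw_def)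
  then show ?thesis
    by (intro group.iso_sym[OF group_S4_S2_S2] is_isoI)
qed

end
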